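(* Let $I \subseteq \mathbb{R}[\mathbf{x}]=\mathbb{R}[x_1,\ldots,x_n]$ be an ideal and let $k$ be a positive integer. If the cone $\mathcal{M}_k(I)$ is closed, then $\mathrm{cl}(Q_k(I)) = \mathrm{TH}_k(I)$.
   Context: $\mathbb{R}[\mathbf{x}]_k$ is the set of polynomials in $\mathbb{R}[x_1,\ldots,x_n]$ of degree at most $k$; a polynomial is called linear if it lies in $\mathbb{R}[\mathbf{x}]_1$ (affine linear). A polynomial $f$ is $k$-sos mod $I$ if there are $h_1,\ldots,h_t\in\mathbb{R}[\mathbf{x}]_k$ with $f-\sum_{j=1}^t h_j^2\in I$. The $k$-th theta body of $I$ is $\mathrm{TH}_k(I):=\{\mathbf{x}\in\mathbb{R}^n : f(\mathbf{x})\ge 0 \text{ for every linear } f \text{ that is } k\text{-sos mod } I\}$. $\mathcal{M}_k(I):=\{s+I : s=\sum_j h_j^2 \text{ (finite sum)},\ h_j\in\mathbb{R}[\mathbf{x}]_k\}\subseteq \mathbb{R}[\mathbf{x}]/I$, a cone contained in the finite-dimensional subspace $\mathbb{R}[\mathbf{x}]_{2k}/I$ (the image of $\mathbb{R}[\mathbf{x}]_{2k}$ in $\mathbb{R}[\mathbf{x}]/I$); closedness of $\mathcal{M}_k(I)$ is with respect to the usual topology of this finite-dimensional space. $(\mathbb{R}[\mathbf{x}]/I)'$ is the space of all linear functionals on $\mathbb{R}[\mathbf{x}]/I$; $\mathcal{M}_k(I)^*$ is the set of $y\in(\mathbb{R}[\mathbf{x}]/I)'$ that are non-negative on $\mathcal{M}_k(I)$;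 $\mathcal{Y}_1:=\{y\in(\mathbb{R}[\mathbf{x}]/I)' : y(1+I)=1\}$; $\pi_I:(\mathbb{R}[\mathbf{x}]/I)'\to\mathbb{R}^n$ is $\pi_I(y)=(y(x_1+I),\ldots,y(x_n+I))$. The $k$-th modified Lasserre relaxation is $Q_k(I):=\pi_I(\mathcal{M}_k(I)^*\cap\mathcal{Y}_1)\subseteq\mathbb{R}^n$. $\mathrm{cl}$ denotes Euclidean closure in $\mathbb{R}^n$. *)

theory Defs
  imports "HOL-Analysis.Analysis" "HOL-Library.Poly_Mapping" "HOL-Library.Set_Algebras"
begin

text \<open>
  The ring R[x_1,...,x_n], with the variables indexed by a finite type \<open>'n\<close>: a polynomial maps
  exponent vectors to coefficients, and the ring multiplication is the convolution product
  of \<open>Poly_Mapping\<close>.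
\<close>

type_synonym 'n rpoly = "('n \<Rightarrow>\<^sub>0 nat) \<Rightarrow>\<^sub>0 real"

definition pconst :: "real \<Rightarrow> 'n rpoly" where
  "pconst c = Poly_Mapping.single 0 c"

definition pvar :: "'n \<Rightarrow> 'n rpoly" where
  "pvar i = Poly_Mapping.single (Poly_Mapping.single i 1) 1"

definition peval :: "('n::finite) rpoly \<Rightarrow> real ^ 'n \<Rightarrow> real" where
  "peval p x =
     (\<Sum>m\<in>Poly_Mapping.keys p.
        Poly_Mapping.lookup p m * (\<Prod>i\<in>UNIV. (x $ i) ^ Poly_Mapping.lookup m i))"

definition polys_upto :: "nat \<Rightarrow> ('n::finite) rpoly set" where
  "polys_upto k =
     {p. \<forall>m\<in>Poly_Mapping.keys p. (\<Sum>i\<in>UNIV. Poly_Mapping.lookup m i) \<le> k}"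

definition poly_ideal :: "'n rpoly set \<Rightarrow> bool" where
  "poly_ideal I \<longleftrightarrow>
     0 \<in> I \<and> (\<forall>p\<in>I. \<forall>q\<in>I. p + q \<in> I) \<and> (\<forall>p. \<forall>q\<in>I. p * q \<in> I)"

definition ksos_mod :: "nat \<Rightarrow> ('n::finite) rpoly set \<Rightarrow> 'n rpoly \<Rightarrow> bool" where
  "ksos_mod k I f \<longleftrightarrow>
     (\<exists>(t::nat) h. (\<forall>j<t. h j \<in> polys_upto k) \<and> f - (\<Sum>j<t. (h j)\<^sup>2) \<in> I)"

definition theta_body :: "nat \<Rightarrow> ('n::finite) rpoly set \<Rightarrow> (real ^ 'n) set" where
  "theta_body k I = {x. \<forall>f\<in>polys_upto 1. ksos_mod k I f \<longrightarrow> peval f x \<ge> 0}"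

text \<open>
  Elements of the quotient R[x]/I are the cosets \<open>p +o I\<close>; the second set below is the image of
  the polynomials of degree at most \<open>k\<close> in the quotient.
\<close>

definition quot_space :: "'n rpoly set \<Rightarrow> 'n rpoly set set" where
  "quot_space I = range (\<lambda>p. p +o I)"

definition quot_upto :: "nat \<Rightarrow> ('n::finite) rpoly set \<Rightarrow> 'n rpoly set set" where
  "quot_upto k I = (\<lambda>p. p +o I) ` polys_upto k"

definition sos_cone :: "nat \<Rightarrow> ('n::finite) rpoly set \<Rightarrow> 'n rpoly set set" where
  "sos_cone k I =
     {(\<Sum>j<t. (h j)\<^sup>2) +o I | (t::nat) h. \<forall>j<t. h j \<in> polys_upto k}"

text \<open>
  The usual topology of a finite-dimensional real vector space is the one carried over from R^d by
  the coordinates with respect to a basis; it does not depend on the basis. Here the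
  space is a subspace of R[x]/I: \<open>b 0 +o I, \<dots>, b (d - 1) +o I\<close> form a basis of \<open>V\<close> iff the linear
  map \<open>quot_comb I d b\<close> is a bijection from R^d onto \<open>V\<close>. The points of \<open>Euclidean_space d\<close> are the
  real sequences vanishing from index \<open>d\<close> on.
\<close>

definition quot_comb ::
    "'n rpoly set \<Rightarrow> nat \<Rightarrow> (nat \<Rightarrow> 'n rpoly) \<Rightarrow> (nat \<Rightarrow> real) \<Rightarrow> 'n rpoly set" where
  "quot_comb I d b c = (\<Sum>i<d. pconst (c i) * b i) +o I"

definition quot_basis ::
    "'n rpoly set \<Rightarrow> 'n rpoly set set \<Rightarrow> nat \<Rightarrow> (nat \<Rightarrow> 'n rpoly) \<Rightarrow> bool" where
  "quot_basis I V d b \<longleftrightarrow> bij_betw (quot_comb I d b) (topspace (Euclidean_space d)) V"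

definition closed_in_quot ::
    "'n rpoly set \<Rightarrow> 'n rpoly set set \<Rightarrow> 'n rpoly set set \<Rightarrow> bool" where
  "closed_in_quot I V S \<longleftrightarrow>
     S \<subseteq> V \<and>
     (\<exists>d b. quot_basis I V d b \<and>
        closedin (Euclidean_space d) {c \<in> topspace (Euclidean_space d). quot_comb I d b c \<in> S})"

text \<open>
  The space of all linear functionals on R[x]/I. A functional is a function on cosets; its
  values outside \<open>quot_space I\<close> carry no meaning and are fixed by \<open>extensional\<close>.
\<close>

definition quot_dual :: "'n rpoly set \<Rightarrow> ('n rpoly set \<Rightarrow> real) set" where
  "quot_dual I =
     {y \<in> extensional (quot_space I).
        (\<forall>p q. y ((p + q) +o I) = y (p +o I) + y (q +o I)) \<and>
        (\<forall>c p. y ((pconst c * p) +o I) = c * y (p +o I))}"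

definition dual_cone :: "'n rpoly set \<Rightarrow> 'n rpoly set set \<Rightarrow> ('n rpoly set \<Rightarrow> real) set" where
  "dual_cone I M = {y \<in> quot_dual I. \<forall>C\<in>M. y C \<ge> 0}"

definition normalized_dual :: "'n rpoly set \<Rightarrow> ('n rpoly set \<Rightarrow> real) set" where
  "normalized_dual I = {y \<in> quot_dual I. y (1 +o I) = 1}"

definition proj_quot :: "'n rpoly set \<Rightarrow> ('n rpoly set \<Rightarrow> real) \<Rightarrow> real ^ ('n::finite)" where
  "proj_quot I y = (\<chi> i. y (pvar i +o I))"

definition lasserre_mod :: "nat \<Rightarrow> ('n::finite) rpoly set \<Rightarrow> (real ^ 'n) set" where
  "lasserre_mod k I = proj_quot I ` (dual_cone I (sos_cone k I) \<inter> normalized_dual I)"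

end

theory Submission
  imports Defs
begin

text \<open>
  A functional \<open>y\<close> with \<open>y(1 + I) = 1\<close> satisfies \<open>y(f + I) = f(\<pi>\<^sub>I(y))\<close> for linear \<open>f\<close>, so the relaxation
  lies in the closed set \<open>TH\<^sub>k(I)\<close>. A point \<open>x\<close> outside the closure of the convex set \<open>Q\<^sub>k(I)\<close> is cut off
  by a linear \<open>f\<close> that is nonnegative on \<open>Q\<^sub>k(I)\<close> with \<open>f(x) < 0\<close> (take \<open>f = -1\<close> if \<open>Q\<^sub>k(I)\<close> is empty). If
  \<open>x\<close> were in \<open>TH\<^sub>k(I)\<close>, then \<open>f + I\<close> would not lie in the closed cone \<open>M\<^sub>k(I)\<close>, and a functional separating
  it from the cone would yield, after normalization at 1, a point of \<open>Q\<^sub>k(I)\<close> at which \<open>f\<close> is negative.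
\<close>

section \<open>Separating a point from a closed convex cone in coordinate space\<close>

text \<open>The separating weights are the difference between the point of \<open>K\<close> nearest
  to \<open>c0\<close> and \<open>c0\<close> itself. Points are real sequences, so the squared
  distance \<open>g\<close> is written out over the first \<open>d\<close> coordinates and
  compactness is taken in the product topology.\<close>

lemma closed_cone_separation_Euclidean_space:
  fixes K :: "(nat \<Rightarrow> real) set"
  assumes clo: "closedin (Euclidean_space d) K"
    and zero: "(\<lambda>i. 0) \<in> K"
    and add: "\<And>a b. a \<in> K \<Longrightarrow> b \<in> K \<Longrightarrow> (\<lambda>i. a i + b i) \<in> K"
    and scale: "\<And>a t. a \<in> K \<Longrightarrow> 0 \<le> t \<Longrightarrow> (\<lambda>i. t * a i) \<in> K"
    and c0: "c0 \<in> topspace (Euclidean_space d)" "c0 \<notin> K"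
  obtains w where "(\<Sum>i<d. w i * c0 i) < 0" "\<And>c. c \<in> K \<Longrightarrow> 0 \<le> (\<Sum>i<d. w i * c i)"
proof -
  define g where "g c = (\<Sum>i<d. (c i - c0 i)\<^sup>2)" for c
  define r where "r = sqrt (g (\<lambda>i. 0))"
  \<comment> \<open>The radius \<open>r\<close> is the distance from \<open>c0\<close> to the
    origin, which lies in \<open>K\<close>, so the box contains every point of \<open>K\<close> at
    least as close as the origin. Coordinates from \<open>d\<close> on are pinned to 0, which makes
    the infinite product of compact sets fit \<open>K\<close>.\<close>
  define B where "B = (\<lambda>i. if i < d then {c0 i - r .. c0 i + r} else {0})"
  have Ksub: "c i = 0" if "c \<in> K" "i \<ge> d" for c i
    using closedin_subset[OF clo] that by (auto simp: topspace_Euclidean_space)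
  have "closed K"
    using clo by (rule closedin_Euclidean_imp_closed)
  moreover have "compact (PiE UNIV B)"
  proof -
    have "compactin (powertop_real UNIV) (PiE UNIV B)"
      by (subst compactin_PiE) (auto simp: B_def)
    then show ?thesis by (simp add: euclidean_product_topology)
  qed
  ultimately have comp: "compact (K \<inter> PiE UNIV B)"
    by (simp add: closed_Int_compact)
  have bound: "\<bar>c i - c0 i\<bar> \<le> r" if "g c \<le> g (\<lambda>i. 0)" "i < d" for c i
  proof -
    have "(c i - c0 i)\<^sup>2 \<le> g c"
      unfolding g_def using that(2)
      by (intro member_le_sum[where f = "\<lambda>i. (c i - c0 i)\<^sup>2"]) auto
    then show ?thesis
      unfolding r_def using that(1) by (metis order_trans real_le_rsqrt real_sqrt_abs real_sqrt_le_iff)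
  qed
  have inbox: "c \<in> PiE UNIV B" if "c \<in> K" "g c \<le> g (\<lambda>i. 0)" for c
    using bound[OF that(2)] Ksub[OF that(1)] by (auto simp: B_def abs_le_iff algebra_simps)
  have "continuous_on (K \<inter> PiE UNIV B) g"
    unfolding g_def
    by (intro continuous_intros continuous_on_subset[OF continuous_on_product_coordinates]) auto
  moreover have "K \<inter> PiE UNIV B \<noteq> {}"
    using inbox[OF zero] zero by auto
  ultimately obtain z where z: "z \<in> K" "z \<in> PiE UNIV B"
    and zmin: "\<And>c. c \<in> K \<inter> PiE UNIV B \<Longrightarrow> g z \<le> g c"
    using continuous_attains_inf[OF comp] by (metis IntD1 IntD2)
  have gz: "g z \<le> g c" if "c \<in> K" for c
  proof (cases "g c \<le> g (\<lambda>i. 0)")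
    case True
    then show ?thesis using zmin inbox[OF that] that by auto
  next
    case False
    then show ?thesis using zmin[of "\<lambda>i. 0"] inbox[OF zero] zero by force
  qed
  \<comment> \<open>\<open>z\<close> is the point of \<open>K\<close> nearest to \<open>c0\<close>; comparing it with \<open>z + t c\<close> and \<open>(1 - t) z\<close> for small \<open>t\<close>
    shows that \<open>w\<close> is nonnegative on \<open>K\<close> and vanishes at \<open>z\<close>.\<close>
  define w where "w = (\<lambda>i. z i - c0 i)"
  have quad: "0 \<le> b" if "\<And>t. 0 < t \<Longrightarrow> t \<le> 1 \<Longrightarrow> 0 \<le> 2 * t * b + t\<^sup>2 * a" for a b :: real
  proof (rule ccontr)
    assume "\<not> 0 \<le> b"
    then have b: "b < 0" by simp
    \<comment> \<open>With this \<open>t\<close> the product \<open>t * a\<close> is at most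
      \<open>- b\<close>, so \<open>2 * b + t * a\<close> is at most \<open>b\<close> and hence
      negative.\<close>
    define t where "t = min 1 (- b / (\<bar>a\<bar> + 1))"
    have t: "0 < t" "t \<le> 1" using b by (auto simp: t_def divide_neg_pos)
    have "t * (\<bar>a\<bar> + 1) \<le> - b"
      using min.cobounded2[of 1 "- b / (\<bar>a\<bar> + 1)"] unfolding t_def[symmetric]
      by (subst (asm) pos_le_divide_eq) auto
    moreover have "t * a \<le> t * (\<bar>a\<bar> + 1)" using t by (intro mult_left_mono) auto
    ultimately have "2 * b + t * a < 0" using b by linarith
    then have "t * (2 * b + t * a) < 0" using t by (simp add: mult_pos_neg)
    with that[OF t] show False by (simp add: power2_eq_square algebra_simps)
  qed
  have expand: "g (\<lambda>i. z i + t * c i) = g z + 2 * t * (\<Sum>i<d. w i * c i) + t\<^sup>2 * (\<Sum>i<d. (c i)\<^sup>2)" for t c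
    unfolding g_def w_def sum_distrib_left sum.distrib[symmetric]
    by (intro sum.cong) (auto simp: power2_eq_square algebra_simps)
  have pos: "0 \<le> (\<Sum>i<d. w i * c i)" if "c \<in> K" for c
  proof (rule quad)
    fix t :: real assume "0 < t" "t \<le> 1"
    then show "0 \<le> 2 * t * (\<Sum>i<d. w i * c i) + t\<^sup>2 * (\<Sum>i<d. (c i)\<^sup>2)"
      using gz[OF add[OF z(1) scale[OF that, of t]]] expand[of t c] by simp
  qed
  have neg: "0 \<le> - (\<Sum>i<d. w i * z i)"
  proof (rule quad)
    fix t :: real assume "0 < t" "t \<le> 1"
    then show "0 \<le> 2 * t * (- (\<Sum>i<d. w i * z i)) + t\<^sup>2 * (\<Sum>i<d. (z i)\<^sup>2)"
      using gz[OF scale[OF z(1), of "1 - t"]] expand[of "- t" z] by (simp add: algebra_simps)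
  qed
  \<comment> \<open>Since \<open>c0\<close> is outside \<open>K\<close>, it differs from
    \<open>z\<close>, and only an index below \<open>d\<close> can witness this. The value of
    \<open>w\<close> at \<open>c0\<close> is its value at \<open>z\<close>, which is at most 0,
    minus this positive square sum.\<close>
  have "0 < (\<Sum>i<d. (w i)\<^sup>2)"
  proof -
    obtain i where i: "z i \<noteq> c0 i" using z(1) c0(2) by (metis ext)
    have "i < d"
      using i Ksub[OF z(1)] c0(1) by (metis (mono_tags, lifting) mem_Collect_eq not_le topspace_Euclidean_space)
    then show ?thesis using i by (intro sum_pos2[of _ i]) (auto simp: w_def)
  qed
  moreover have "(\<Sum>i<d. w i * c0 i) = (\<Sum>i<d. w i * z i) - (\<Sum>i<d. (w i)\<^sup>2)"
    unfolding sum_subtractf[symmetric] by (simp add: w_def power2_eq_square algebra_simps)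
  ultimately have "(\<Sum>i<d. w i * c0 i) < 0" using neg by linarith
  then show ?thesis using pos by (rule that)
qed

section \<open>Polynomials as a real vector space: degree and evaluation\<close>

text \<open>Scalars act through multiplication by constant polynomials; subspaces, linear maps and
  linear projections of polynomials are then at hand.\<close>

interpretation rpoly: vector_space "\<lambda>(c::real) (p::'n rpoly). pconst c * p"
  by unfold_locales
    (auto simp: pconst_def algebra_simps mult_single single_add single_one simp flip: mult.assoc)

lemma keys_pconst_mult_subset: "Poly_Mapping.keys (pconst c * p) \<subseteq> Poly_Mapping.keys p"
  using keys_mult[of "pconst c" p] by (auto simp: pconst_def split: if_splits)

lemma lookup_pconst_mult: "Poly_Mapping.lookup (pconst c * p) m = c * Poly_Mapping.lookup p m"
  by (simp add: pconst_def map.rep_eq when_def flip: mult_map_scale_conv_mult)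

lemma zero_in_polys_upto [simp]: "0 \<in> polys_upto k"
  by (simp add: polys_upto_def)

lemma polys_upto_add: "p \<in> polys_upto k \<Longrightarrow> q \<in> polys_upto k \<Longrightarrow> p + q \<in> polys_upto k"
  using keys_add[of p q] by (auto simp: polys_upto_def)

lemma polys_upto_pconst_mult: "p \<in> polys_upto k \<Longrightarrow> pconst c * p \<in> polys_upto k"
  using keys_pconst_mult_subset[of c p] by (auto simp: polys_upto_def)

lemma polys_upto_mono: "j \<le> k \<Longrightarrow> polys_upto j \<subseteq> polys_upto k"
  by (auto simp: polys_upto_def)

lemma polys_upto_sum: "(\<And>i. i \<in> A \<Longrightarrow> p i \<in> polys_upto k) \<Longrightarrow> (\<Sum>i\<in>A. p i) \<in> polys_upto k"
  by (induction A rule: infinite_finite_induct) (auto intro: polys_upto_add)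

lemma one_in_polys_upto [simp]: "1 \<in> polys_upto k"
  by (simp add: polys_upto_def)

lemma sum_lookup_single: "(\<Sum>j\<in>UNIV. Poly_Mapping.lookup (Poly_Mapping.single (i::'n::finite) a) j) = a"
  by (simp add: lookup_single when_def)

lemma pvar_in_polys_upto: "1 \<le> k \<Longrightarrow> pvar (i::'n::finite) \<in> polys_upto k"
  by (simp add: polys_upto_def pvar_def sum_lookup_single)

text \<open>Serves to evaluate polynomials with different supports over one common index
  set.\<close>

lemma peval_superset:
  assumes "finite S" "Poly_Mapping.keys p \<subseteq> S"
  shows "peval p x = (\<Sum>m\<in>S. Poly_Mapping.lookup p m * (\<Prod>i\<in>UNIV. (x $ i) ^ Poly_Mapping.lookup m i))"
  unfolding peval_def using assms by (intro sum.mono_neutral_left) (auto simp: in_keys_iff)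

lemma peval_add: "peval (p + q) x = peval p x + peval q x"
proof -
  let ?S = "Poly_Mapping.keys p \<union> Poly_Mapping.keys q"
  show ?thesis
    using keys_add[of p q]
    by (simp add: peval_superset[of ?S] lookup_add algebra_simps sum.distrib)
qed

lemma peval_pconst_mult: "peval (pconst c * p) x = c * peval p x"
  using keys_pconst_mult_subset[of c p]
  by (simp add: peval_superset[of "Poly_Mapping.keys p"] lookup_pconst_mult sum_distrib_left mult.assoc)

lemma peval_zero [simp]: "peval 0 x = 0"
  by (simp add: peval_def)

lemma peval_one [simp]: "peval 1 x = 1"
  by (simp add: peval_def)

lemma peval_sum: "peval (\<Sum>i\<in>A. p i) x = (\<Sum>i\<in>A. peval (p i) x)"
  by (induction A rule: infinite_finite_induct) (auto simp: peval_add)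

lemma prod_power_single:
  "(\<Prod>j\<in>UNIV. (x $ j) ^ Poly_Mapping.lookup (Poly_Mapping.single (i::'n::finite) 1) j) = (x $ i :: real)"
proof -
  have "(x $ j) ^ Poly_Mapping.lookup (Poly_Mapping.single i 1) j = (if j = i then x $ i else 1)" for j
    by (simp add: lookup_single when_def)
  then show ?thesis by simp
qed

lemma peval_pvar [simp]: "peval (pvar i) x = x $ i"
  using prod_power_single[of x i] by (simp add: peval_def pvar_def)

lemma continuous_on_peval: "continuous_on A (peval p)"
  unfolding peval_def by (intro continuous_intros)

lemma closed_theta_body: "closed (theta_body k I)"
proof -
  have "theta_body k I = (\<Inter>f\<in>{f \<in> polys_upto 1. ksos_mod k I f}. {x. 0 \<le> peval f x})"
    by (auto simp: theta_body_def)
  then show ?thesis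
    by (auto intro!: closed_INT closed_Collect_le continuous_on_peval)
qed

text \<open>One nonzero exponent already exhausts the degree bound, which forces all the others to
  vanish.\<close>

lemma monomial_of_degree_le_1:
  fixes m :: "'n::finite \<Rightarrow>\<^sub>0 nat"
  assumes "(\<Sum>i\<in>UNIV. Poly_Mapping.lookup m i) \<le> 1"
  obtains "m = 0" | i where "m = Poly_Mapping.single i 1"
proof (cases "m = 0")
  case False
  then obtain i where i: "Poly_Mapping.lookup m i \<noteq> 0" by (auto simp: poly_mapping_eq_iff fun_eq_iff)
  have *: "Poly_Mapping.lookup m i + (\<Sum>j\<in>UNIV - {i}. Poly_Mapping.lookup m j) \<le> 1"
    using assms by (simp add: sum.remove[of UNIV i])
  then have "(\<Sum>j\<in>UNIV - {i}. Poly_Mapping.lookup m j) = 0" "Poly_Mapping.lookup m i = 1"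
    using i by linarith+
  then have "m = Poly_Mapping.single i 1"
    by (intro poly_mapping_eqI) (auto simp: lookup_single when_def)
  then show ?thesis by (rule that(2))
qed (use that in auto)

lemma rpoly_sum_monomials:
  "(p :: 'n rpoly) = (\<Sum>m\<in>Poly_Mapping.keys p. pconst (Poly_Mapping.lookup p m) * Poly_Mapping.single m 1)"
  by (rule poly_mapping_eqI)
    (simp add: lookup_sum lookup_pconst_mult lookup_single when_def if_distrib in_keys_iff sum.If_cases cong: if_cong)

text \<open>By linearity it is enough to compare both sides on monomials, and the degree bound
  leaves only 1 and the variables, where they agree.\<close>

lemma linear_functional_affine_eq_peval:
  fixes L :: "('n::finite) rpoly \<Rightarrow> real"
  assumes L: "module_hom (\<lambda>c p. pconst c * p) (*) L" and "L 1 = 1" and f: "f \<in> polys_upto 1"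
  shows "L f = peval f (\<chi> i. L (pvar i))"
proof -
  interpret module_hom "\<lambda>c p. pconst c * p" "(*)" L by fact
  have "L (Poly_Mapping.single m 1) = (\<Prod>i\<in>UNIV. L (pvar i) ^ Poly_Mapping.lookup m i)"
    if "m \<in> Poly_Mapping.keys f" for m
  proof -
    have "(\<Sum>i\<in>UNIV. Poly_Mapping.lookup m i) \<le> 1" using f that by (auto simp: polys_upto_def)
    then show ?thesis
    proof (cases rule: monomial_of_degree_le_1)
      case 1
      then show ?thesis using \<open>L 1 = 1\<close> by simp
    next
      case (2 i)
      then show ?thesis
        using prod_power_single[of "\<chi> i. L (pvar i)" i] by (simp add: pvar_def)
    qed
  qed
  then show ?thesis
    by (subst rpoly_sum_monomials[of f]) (simp add: peval_def sum scale)
qed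

section \<open>Cosets modulo the ideal and the cone of sums of squares\<close>

lemma poly_ideal_subspace: "poly_ideal I \<Longrightarrow> rpoly.subspace I"
  by (auto simp: rpoly.subspace_def poly_ideal_def)

lemma coset_eq_iff:
  assumes "poly_ideal I"
  shows "p +o I = q +o I \<longleftrightarrow> p - q \<in> I"
proof
  note sub = poly_ideal_subspace[OF assms]
  assume "p +o I = q +o I"
  moreover have "p \<in> p +o I"
    using rpoly.subspace_0[OF sub] by (auto simp: elt_set_plus_def)
  ultimately obtain r where "r \<in> I" "p = q + r" by (auto simp: elt_set_plus_def)
  then show "p - q \<in> I" by simp
next
  note sub = poly_ideal_subspace[OF assms]
  have *: "a +o I \<subseteq> c +o I" if "a - c \<in> I" for a c
  proof
    fix x assume "x \<in> a +o I"
    then obtain r where "r \<in> I" "x = a + r" by (auto simp: elt_set_plus_def)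
    then have "r \<in> I" "x = c + ((a - c) + r)" by simp_all
    then show "x \<in> c +o I"
      using rpoly.subspace_add[OF sub that] unfolding elt_set_plus_def by blast
  qed
  assume "p - q \<in> I"
  then show "p +o I = q +o I"
    using * rpoly.subspace_neg[OF sub, of "p - q"] by (metis minus_diff_eq subset_antisym)
qed

lemma coset_add:
  assumes "poly_ideal I" "p +o I = p' +o I" "q +o I = q' +o I"
  shows "(p + q) +o I = (p' + q') +o I"
  using assms rpoly.subspace_add[OF poly_ideal_subspace[OF assms(1)], of "p - p'" "q - q'"]
  by (simp add: coset_eq_iff algebra_simps)

lemma coset_pconst_mult:
  assumes "poly_ideal I" "p +o I = p' +o I"
  shows "(pconst c * p) +o I = (pconst c * p') +o I"
  using assms rpoly.subspace_scale[OF poly_ideal_subspace[OF assms(1)], of "p - p'" c]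
  by (simp add: coset_eq_iff algebra_simps)

text \<open>Links the theta body, defined through polynomials, with the cone, which consists of
  cosets.\<close>

lemma ksos_mod_iff: "poly_ideal I \<Longrightarrow> ksos_mod k I f \<longleftrightarrow> f +o I \<in> sos_cone k I"
  by (auto simp: ksos_mod_def sos_cone_def coset_eq_iff)

lemma sos_cone_zero: "0 +o I \<in> sos_cone k I"
  by (auto simp: sos_cone_def intro!: exI[of _ 0])

lemma sos_cone_add:
  assumes I: "poly_ideal I" and "p +o I \<in> sos_cone k I" "q +o I \<in> sos_cone k I"
  shows "(p + q) +o I \<in> sos_cone k I"
proof -
  obtain t :: nat and h where h: "\<And>j. j < t \<Longrightarrow> h j \<in> polys_upto k" "p +o I = (\<Sum>j<t. (h j)\<^sup>2) +o I"
    using assms(2) by (auto simp: sos_cone_def)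
  obtain u :: nat and g where g: "\<And>j. j < u \<Longrightarrow> g j \<in> polys_upto k" "q +o I = (\<Sum>j<u. (g j)\<^sup>2) +o I"
    using assms(3) by (auto simp: sos_cone_def)
  \<comment> \<open>The two families of squares are concatenated.\<close>
  define f where "f j = (if j < t then h j else g (j - t))" for j
  have "(\<Sum>j<t + u. (f j)\<^sup>2) = (\<Sum>j<t. (f j)\<^sup>2) + (\<Sum>j<u. (f (t + j))\<^sup>2)"
    by (induction u) (auto simp: add.assoc)
  then have "(p + q) +o I = (\<Sum>j<t + u. (f j)\<^sup>2) +o I"
    using coset_add[OF I h(2) g(2)] by (simp add: f_def)
  moreover have "\<forall>j<t + u. f j \<in> polys_upto k"
    using h(1) g(1) by (auto simp: f_def)
  ultimately show ?thesis unfolding sos_cone_def by blast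
qed

text \<open>A nonnegative constant is the square of its root and can be absorbed into each square
  without raising the degree.\<close>

lemma sos_cone_scale:
  fixes I :: "('n::finite) rpoly set"
  assumes I: "poly_ideal I" and "p +o I \<in> sos_cone k I" "0 \<le> c"
  shows "(pconst c * p) +o I \<in> sos_cone k I"
proof -
  obtain t :: nat and h where h: "\<And>j. j < t \<Longrightarrow> h j \<in> polys_upto k" "p +o I = (\<Sum>j<t. (h j)\<^sup>2) +o I"
    using assms(2) by (auto simp: sos_cone_def)
  have "(pconst (sqrt c))\<^sup>2 = (pconst c :: 'n rpoly)"
    using \<open>0 \<le> c\<close> by (simp add: pconst_def power2_eq_square mult_single)
  then have "(pconst c * p) +o I = (\<Sum>j<t. (pconst (sqrt c) * h j)\<^sup>2) +o I"
    using coset_pconst_mult[OF I h(2), of c] by (simp add: sum_distrib_left power_mult_distrib)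
  moreover have "\<forall>j<t. pconst (sqrt c) * h j \<in> polys_upto k"
    using h(1) polys_upto_pconst_mult by auto
  ultimately show ?thesis
    unfolding sos_cone_def by (intro CollectI exI[of _ t] exI[of _ "\<lambda>j. pconst (sqrt c) * h j"]) simp
qed

lemma one_in_sos_cone: "1 +o I \<in> sos_cone k I"
  unfolding sos_cone_def by (auto intro!: exI[of _ 1] exI[of _ "\<lambda>_. 1"])

section \<open>Functionals nonnegative on the cone, and the relaxation they define\<close>

text \<open>The dual cone of the sums of squares, pulled back along the quotient map: functionals on
  polynomials that vanish on \<open>I\<close>. This form dispenses with coset representatives and
  extensionality.\<close>

definition sos_functionals :: "nat \<Rightarrow> ('n::finite) rpoly set \<Rightarrow> ('n rpoly \<Rightarrow> real) set" where
  "sos_functionals k I =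
     {L. module_hom (\<lambda>c p. pconst c * p) (*) L \<and> (\<forall>p\<in>I. L p = 0) \<and>
         (\<forall>p. p +o I \<in> sos_cone k I \<longrightarrow> 0 \<le> L p)}"

lemma module_hom_rpolyI:
  assumes "\<And>p q. L (p + q) = L p + L q" "\<And>c p. L (pconst c * p) = c * L p"
  shows "module_hom (\<lambda>c p. pconst c * p) ((*) :: real \<Rightarrow> _) L"
  using assms by unfold_locales (auto simp: algebra_simps)

text \<open>Used for convexity of the relaxation, for normalization at 1 and for perturbing a
  functional.\<close>

lemma sos_functionals_combine:
  assumes "L \<in> sos_functionals k I" "L' \<in> sos_functionals k I" "0 \<le> s" "0 \<le> t"
  shows "(\<lambda>p. s * L p + t * L' p) \<in> sos_functionals k I"
  using assms unfolding sos_functionals_def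
  by (auto intro!: module_hom_rpolyI simp: module_hom.add
      module_hom.scale[of "\<lambda>c p. pconst c * p" "(*)"] distrib_left)

lemma sos_functional_of_dual_cone:
  assumes I: "poly_ideal I" and y: "y \<in> dual_cone I (sos_cone k I)"
  shows "(\<lambda>p. y (p +o I)) \<in> sos_functionals k I"
proof -
  have lin: "module_hom (\<lambda>c p. pconst c * p) (*) (\<lambda>p. y (p +o I))"
    using y by (intro module_hom_rpolyI) (auto simp: dual_cone_def quot_dual_def)
  have "y (p +o I) = 0" if "p \<in> I" for p
    using coset_eq_iff[OF I, of p 0] module_hom.zero[OF lin] that by simp
  then show ?thesis
    using y lin by (auto simp: sos_functionals_def dual_cone_def)
qed

text \<open>A functional vanishing on \<open>I\<close> is constant on cosets, so its value may be
  read off at any chosen representative; the restriction supplies extensionality.\<close>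

lemma dual_cone_of_sos_functional:
  assumes I: "poly_ideal I" and L: "L \<in> sos_functionals k I"
  obtains y where "y \<in> dual_cone I (sos_cone k I)" "\<And>p. y (p +o I) = L p"
proof
  define y where "y = restrict (\<lambda>C. L (SOME p. C = p +o I)) (quot_space I)"
  interpret module_hom "\<lambda>c p. pconst c * p" "(*)" L
    using L by (simp add: sos_functionals_def)
  show y: "y (p +o I) = L p" for p
  proof -
    have "p +o I = (SOME q. p +o I = q +o I) +o I" by (rule someI) simp
    then have "L (p - (SOME q. p +o I = q +o I)) = 0"
      using L by (simp add: coset_eq_iff[OF I] sos_functionals_def)
    then show ?thesis by (simp add: y_def quot_space_def diff)
  qed
  have "0 \<le> y C" if C: "C \<in> sos_cone k I" for C
  proof -
    obtain p where "C = p +o I" using C unfolding sos_cone_def by blast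
    then show ?thesis using C y L by (simp add: sos_functionals_def)
  qed
  then show "y \<in> dual_cone I (sos_cone k I)"
    by (auto simp: dual_cone_def quot_dual_def y add scale) (simp add: y_def)
qed

lemma lasserre_mod_eq:
  assumes I: "poly_ideal I"
  shows "lasserre_mod k I = (\<lambda>L. \<chi> i. L (pvar i)) ` {L \<in> sos_functionals k I. L 1 = 1}"
proof (intro equalityI subsetI)
  fix x assume "x \<in> lasserre_mod k I"
  then obtain y where y: "y \<in> dual_cone I (sos_cone k I)" "y (1 +o I) = 1" "x = (\<chi> i. y (pvar i +o I))"
    by (auto simp: lasserre_mod_def normalized_dual_def proj_quot_def)
  then show "x \<in> (\<lambda>L. \<chi> i. L (pvar i)) ` {L \<in> sos_functionals k I. L 1 = 1}"
    using sos_functional_of_dual_cone[OF I y(1)] by (intro image_eqI[of _ _ "\<lambda>p. y (p +o I)"]) auto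
next
  fix x assume "x \<in> (\<lambda>L. \<chi> i. L (pvar i)) ` {L \<in> sos_functionals k I. L 1 = 1}"
  then obtain L where L: "L \<in> sos_functionals k I" "L 1 = 1" "x = (\<chi> i. L (pvar i))" by auto
  obtain y where y: "y \<in> dual_cone I (sos_cone k I)" "\<And>p. y (p +o I) = L p"
    using dual_cone_of_sos_functional[OF I L(1)] by blast
  then show "x \<in> lasserre_mod k I"
    using L unfolding lasserre_mod_def
    by (intro image_eqI[of _ _ y]) (auto simp: proj_quot_def normalized_dual_def dual_cone_def)
qed

text \<open>Convex combinations of functionals with value 1 at 1 keep that value, and
  \<open>L\<close> enters the coordinates linearly.\<close>

lemma convex_lasserre_mod:
  assumes I: "poly_ideal I"
  shows "convex (lasserre_mod k I)"
proof (rule convexI)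
  fix x x' and u v :: real
  assume "x \<in> lasserre_mod k I" "x' \<in> lasserre_mod k I" and uv: "0 \<le> u" "0 \<le> v" "u + v = 1"
  then obtain L L' where L: "L \<in> sos_functionals k I" "L 1 = 1" "x = (\<chi> i. L (pvar i))"
    and L': "L' \<in> sos_functionals k I" "L' 1 = 1" "x' = (\<chi> i. L' (pvar i))"
    by (auto simp: lasserre_mod_eq[OF I])
  show "u *\<^sub>R x + v *\<^sub>R x' \<in> lasserre_mod k I"
    unfolding lasserre_mod_eq[OF I]
    using sos_functionals_combine[OF L(1) L'(1) uv(1,2)] L L' uv
    by (intro image_eqI[of _ _ "\<lambda>p. u * L p + v * L' p"]) (auto simp: vec_eq_iff)
qed

section \<open>Separating a coset from the closed cone\<close>

text \<open>Basis coordinates turn the cone into a closed cone in R^d. Weights that separate there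
  are pulled back to a functional on polynomials.\<close>

lemma sos_cone_separation:
  fixes I :: "('n::finite) rpoly set"
  assumes I: "poly_ideal I"
    and clo: "closed_in_quot I (quot_upto m I) (sos_cone k I)"
    and f: "f \<in> polys_upto m" "f +o I \<notin> sos_cone k I"
  obtains L where "L \<in> sos_functionals k I" "L f < 0"
proof -
  note sub = poly_ideal_subspace[OF I]
  obtain d b where bas: "quot_basis I (quot_upto m I) d b"
    and cloK: "closedin (Euclidean_space d) {c \<in> topspace (Euclidean_space d). quot_comb I d b c \<in> sos_cone k I}"
    and sosV: "sos_cone k I \<subseteq> quot_upto m I"
    using clo by (auto simp: closed_in_quot_def)
  define E where "E = topspace (Euclidean_space d)"
  define K where "K = {c \<in> E. quot_comb I d b c \<in> sos_cone k I}"
  have bij: "bij_betw (quot_comb I d b) E (quot_upto m I)"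
    using bas by (simp add: quot_basis_def E_def)
  have Eadd: "(\<lambda>i. a i + c i) \<in> E" if "a \<in> E" "c \<in> E" for a c
    using that by (simp add: E_def topspace_Euclidean_space)
  have Escale: "(\<lambda>i. t * c i) \<in> E" if "c \<in> E" for t c
    using that by (simp add: E_def topspace_Euclidean_space)
  have E0: "(\<lambda>i. 0) \<in> E"
    by (simp add: E_def topspace_Euclidean_space)
  have comb_add: "quot_comb I d b (\<lambda>i. a i + c i) =
      ((\<Sum>i<d. pconst (a i) * b i) + (\<Sum>i<d. pconst (c i) * b i)) +o I" for a c
    by (simp add: quot_comb_def rpoly.scale_left_distrib sum.distrib)
  have comb_scale: "quot_comb I d b (\<lambda>i. t * c i) = (pconst t * (\<Sum>i<d. pconst (c i) * b i)) +o I" for t c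
    by (simp add: quot_comb_def rpoly.scale_sum_right)
  have comb_0: "quot_comb I d b (\<lambda>i. 0) = 0 +o I"
    by (simp add: quot_comb_def)
  \<comment> \<open>\<open>W\<close> is the set of polynomials congruent modulo \<open>I\<close> to
    one of degree at most \<open>m\<close>. It contains \<open>I\<close>, so a functional given on
    \<open>W\<close> by coset coordinates vanishes on \<open>I\<close>.\<close>
  define W where "W = {p. p +o I \<in> quot_upto m I}"
  have W_polys: "p \<in> W" if "p \<in> polys_upto m" for p
    using that by (auto simp: W_def quot_upto_def)
  have subW: "rpoly.subspace W"
    unfolding rpoly.subspace_def
  proof (intro conjI ballI allI)
    show "0 \<in> W" by (rule W_polys) simp
  next
    fix p q assume "p \<in> W" "q \<in> W"
    then obtain p' q' where *: "p +o I = p' +o I" "q +o I = q' +o I" "p' \<in> polys_upto m" "q' \<in> polys_upto m"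
      by (auto simp: W_def quot_upto_def)
    then show "p + q \<in> W"
      using coset_add[OF I *(1,2)] polys_upto_add[OF *(3,4)] by (auto simp: W_def quot_upto_def)
  next
    fix c p assume "p \<in> W"
    then obtain p' where *: "p +o I = p' +o I" "p' \<in> polys_upto m"
      by (auto simp: W_def quot_upto_def)
    then show "pconst c * p \<in> W"
      using coset_pconst_mult[OF I *(1)] polys_upto_pconst_mult[OF *(2)] by (auto simp: W_def quot_upto_def)
  qed
  \<comment> \<open>Coordinates of the coset of \<open>p\<close> in the basis \<open>b\<close>.
    Their linearity follows from uniqueness: combined coordinate vectors represent the combined
    coset.\<close>
  define co where "co p = inv_into E (quot_comb I d b) (p +o I)" for p
  have coE: "co p \<in> E" and co: "quot_comb I d b (co p) = p +o I" if "p \<in> W" for p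
    using that bij by (auto simp: co_def W_def bij_betw_def inv_into_into f_inv_into_f)
  have coI: "co p = c" if "c \<in> E" "quot_comb I d b c = p +o I" for c p
    using that bij by (auto simp: co_def bij_betw_def intro: inv_into_f_eq)
  have co_add: "co (p + q) = (\<lambda>i. co p i + co q i)" if "p \<in> W" "q \<in> W" for p q
    using coset_add[OF I co[OF that(1), unfolded quot_comb_def] co[OF that(2), unfolded quot_comb_def]]
    by (intro coI Eadd coE that) (simp add: comb_add)
  have co_scale: "co (pconst c * p) = (\<lambda>i. c * co p i)" if "p \<in> W" for c p
    using coset_pconst_mult[OF I co[OF that, unfolded quot_comb_def]]
    by (intro coI Escale coE that) (simp add: comb_scale)
  have fW: "f \<in> W" using f by (intro W_polys)
  have "co f \<in> E" "co f \<notin> K"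
    using coE[OF fW] co[OF fW] f by (auto simp: K_def)
  moreover have "closedin (Euclidean_space d) K"
    using cloK by (simp add: K_def E_def)
  moreover have "(\<lambda>i. 0) \<in> K"
    using E0 comb_0 sos_cone_zero by (auto simp: K_def)
  moreover have "(\<lambda>i. a i + c i) \<in> K" if "a \<in> K" "c \<in> K" for a c
    using that sos_cone_add[OF I] Eadd by (auto simp: K_def comb_add) (auto simp: quot_comb_def)
  moreover have "(\<lambda>i. t * a i) \<in> K" if "a \<in> K" "0 \<le> t" for a t
    using that sos_cone_scale[OF I] Escale by (auto simp: K_def comb_scale) (auto simp: quot_comb_def)
  ultimately obtain w where w: "(\<Sum>i<d. w i * co f i) < 0" "\<And>c. c \<in> K \<Longrightarrow> 0 \<le> (\<Sum>i<d. w i * c i)"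
    unfolding E_def using closed_cone_separation_Euclidean_space[of d K "co f"] by blast
  interpret rp: vector_space_pair "\<lambda>c p. pconst c * p :: 'n rpoly" "\<lambda>c p. pconst c * p :: 'n rpoly"
    by unfold_locales
  have "Vector_Spaces.linear (\<lambda>c p. pconst c * p) (\<lambda>c p. pconst c * p) (\<lambda>p :: 'n rpoly. p)"
    using rpoly.linear_id by (simp add: id_def)
  from rp.linear_exists_left_inverse_on[OF this subW]
  \<comment> \<open>The functional is only given on \<open>W\<close>; a linear projection onto \<open>W\<close> extends it.\<close>
  obtain P where P: "range P \<subseteq> W" "Vector_Spaces.linear (\<lambda>c p. pconst c * p) (\<lambda>c p. pconst c * p) P"
      "\<And>p. p \<in> W \<Longrightarrow> P p = p"
    by auto
  interpret P: Vector_Spaces.linear "\<lambda>c p. pconst c * p" "\<lambda>c p. pconst c * p" P by fact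
  have PW: "P p \<in> W" for p using P(1) by auto
  define L where "L p = (\<Sum>i<d. w i * co (P p) i)" for p
  have "module_hom (\<lambda>c p. pconst c * p) (*) L"
    by (rule module_hom_rpolyI)
      (auto simp: L_def P.add P.scale co_add[OF PW PW] co_scale[OF PW] distrib_left mult.left_commute
        sum.distrib sum_distrib_left)
  moreover have "L p = 0" if "p \<in> I" for p
  proof -
    have eq: "p +o I = 0 +o I" using coset_eq_iff[OF I, of p 0] that by simp
    then have "p \<in> W" using rpoly.subspace_0[OF subW] by (simp add: W_def)
    moreover have "co p = (\<lambda>i. 0)" by (rule coI) (simp_all add: E0 comb_0 eq)
    ultimately show ?thesis by (simp add: L_def P)
  qed
  moreover have "0 \<le> L p" if "p +o I \<in> sos_cone k I" for p
  proof -
    \<comment> \<open>The cone lies in the span of the basis, so \<open>p\<close> is fixed by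
      \<open>P\<close> and its coordinates belong to \<open>K\<close>.\<close>
    have "p \<in> W" using that sosV by (auto simp: W_def)
    moreover from this have "co p \<in> K" using coE co that by (simp add: K_def)
    ultimately show ?thesis using w(2) by (simp add: L_def P)
  qed
  ultimately have "L \<in> sos_functionals k I" by (simp add: sos_functionals_def)
  moreover have "L f < 0" using w(1) fW by (simp add: L_def P)
  ultimately show ?thesis by (rule that)
qed

section \<open>Comparing the relaxation with the theta body\<close>

lemma lasserre_mod_subset_theta_body:
  assumes I: "poly_ideal I"
  shows "lasserre_mod k I \<subseteq> theta_body k I"
proof
  fix x assume "x \<in> lasserre_mod k I"
  then obtain L where L: "L \<in> sos_functionals k I" "L 1 = 1" "x = (\<chi> i. L (pvar i))"
    by (auto simp: lasserre_mod_eq[OF I])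
  then show "x \<in> theta_body k I"
    using linear_functional_affine_eq_peval[of L]
    by (auto simp: theta_body_def ksos_mod_iff[OF I] sos_functionals_def)
qed

theorem theorem2p8:
  fixes I :: "('n::finite) rpoly set" and k :: nat
  assumes "poly_ideal I" and "k \<ge> 1"
    and "closed_in_quot I (quot_upto (2 * k) I) (sos_cone k I)"
  shows "closure (lasserre_mod k I) = theta_body k I"
proof
  note I = \<open>poly_ideal I\<close>
  show "closure (lasserre_mod k I) \<subseteq> theta_body k I"
    by (intro closure_minimal lasserre_mod_subset_theta_body closed_theta_body I)
  \<comment> \<open>As \<open>k\<close> is positive, a linear \<open>f\<close> has degree at most
    \<open>2 * k\<close>, the degree at which the cone is assumed closed.\<close>
  have sep: thesis
    if "f \<in> polys_upto 1" "f +o I \<notin> sos_cone k I"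
      "\<And>L. L \<in> sos_functionals k I \<Longrightarrow> L f < 0 \<Longrightarrow> thesis" for f thesis
    using sos_cone_separation[OF I assms(3), of f] polys_upto_mono[of 1 "2 * k"] \<open>k \<ge> 1\<close> that by auto
  have normalize: "\<exists>z\<in>lasserre_mod k I. \<forall>f\<in>polys_upto 1. peval f z = L f / L 1"
    if L: "L \<in> sos_functionals k I" "0 < L 1" for L
  proof -
    \<comment> \<open>The zero summand casts the scaling by \<open>1 / L 1\<close> as a nonnegative
      combination.\<close>
    define M where "M = (\<lambda>p. 1 / L 1 * L p + 0 * L p)"
    have M: "M \<in> sos_functionals k I"
      unfolding M_def using L by (intro sos_functionals_combine) auto
    have "M 1 = 1" using L by (simp add: M_def)
    moreover from this M have "peval f (\<chi> i. M (pvar i)) = M f" if "f \<in> polys_upto 1" for f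
      using linear_functional_affine_eq_peval[of M f] that by (simp add: sos_functionals_def)
    ultimately show ?thesis
      using M by (intro bexI[of _ "\<chi> i. M (pvar i)"]) (auto simp: lasserre_mod_eq[OF I] M_def)
  qed
  have sep_point: "\<exists>z\<in>lasserre_mod k I. peval f z < 0"
    if f: "f \<in> polys_upto 1" "f +o I \<notin> sos_cone k I" and ne: "lasserre_mod k I \<noteq> {}" for f
  proof -
    obtain L where L: "L \<in> sos_functionals k I" "L f < 0" using sep[OF f] by blast
    obtain N where N: "N \<in> sos_functionals k I" "N 1 = 1"
      using ne by (auto simp: lasserre_mod_eq[OF I])
    \<comment> \<open>1 is itself a square.\<close>
    have "0 \<le> L 1" using L one_in_sos_cone by (auto simp: sos_functionals_def)
    \<comment> \<open>\<open>L\<close> may vanish at 1, so it is perturbed by a small multiple of \<open>N\<close>.\<close>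
    define e where "e = - L f / (2 * (\<bar>N f\<bar> + 1))"
    have e: "0 < e" using L by (auto simp: e_def divide_neg_pos)
    \<comment> \<open>The size of \<open>e\<close> keeps \<open>e * N f\<close> below half of
      \<open>- L f\<close>, so the perturbed functional stays negative at \<open>f\<close> while
      becoming positive at 1.\<close>
    have "e * N f \<le> e * (\<bar>N f\<bar> + 1)" using e by (intro mult_left_mono) auto
    also have "\<dots> = - L f / 2"
    proof -
      have "\<bar>N f\<bar> + 1 \<noteq> 0" by linarith
      then show ?thesis by (simp add: e_def field_simps)
    qed
    finally have neg: "1 * L f + e * N f < 0" using L by linarith
    have pos: "0 < 1 * L 1 + e * N 1" using N \<open>0 \<le> L 1\<close> e by simp
    have "(\<lambda>p. 1 * L p + e * N p) \<in> sos_functionals k I"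
      using L N e by (intro sos_functionals_combine) auto
    from normalize[OF this pos] obtain z where
      "z \<in> lasserre_mod k I" "peval f z = (1 * L f + e * N f) / (1 * L 1 + e * N 1)"
      using f(1) by blast
    then show ?thesis using neg pos by (metis divide_neg_pos)
  qed
  show "theta_body k I \<subseteq> closure (lasserre_mod k I)"
  proof (rule subsetI, rule ccontr)
    fix x assume x: "x \<in> theta_body k I" "x \<notin> closure (lasserre_mod k I)"
    have theta: "f +o I \<notin> sos_cone k I" if "f \<in> polys_upto 1" "peval f x < 0" for f
      using x(1) that by (force simp: theta_body_def ksos_mod_iff[OF I])
    show False
    proof (cases "lasserre_mod k I = {}")
      case True
      \<comment> \<open>Here no normalized functional exists to perturb with. For the constant -1
        none is required: a functional negative at -1 is positive at 1, and normalizing it gives a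
        point of the empty relaxation.\<close>
      let ?f = "pconst (- 1) * 1 :: 'n rpoly"
      have "?f \<in> polys_upto 1" by (intro polys_upto_pconst_mult one_in_polys_upto)
      moreover have "peval ?f x < 0" by (simp only: peval_pconst_mult peval_one)
      ultimately obtain L where L: "L \<in> sos_functionals k I" "L ?f < 0"
        using sep theta by blast
      then have "0 < L 1"
        using module_hom.scale[of "\<lambda>c p. pconst c * p" "(*)" L "- 1" 1] by (simp add: sos_functionals_def)
      then show False using normalize[OF L(1)] True by auto
    next
      case False
      obtain a \<beta> where ab: "a \<bullet> x < \<beta>" "\<And>z. z \<in> closure (lasserre_mod k I) \<Longrightarrow> \<beta> < a \<bullet> z"
        using separating_hyperplane_closed_point[OF convex_closure[OF convex_lasserre_mod[OF I]] closed_closure x(2)]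
        by blast
      \<comment> \<open>The affine function of the separating hyperplane: negative at
        \<open>x\<close>, so its coset is outside the cone, yet positive on the relaxation, against
        \<open>sep_point\<close>.\<close>
      define f where "f = (\<Sum>i\<in>UNIV. pconst (a $ i) * pvar i) + pconst (- \<beta>) * 1"
      have "f \<in> polys_upto 1" unfolding f_def
        by (intro polys_upto_add polys_upto_sum polys_upto_pconst_mult pvar_in_polys_upto one_in_polys_upto) simp
      moreover have ev: "peval f z = a \<bullet> z - \<beta>" for z
        unfolding f_def peval_add peval_sum peval_pconst_mult by (simp add: inner_vec_def)
      ultimately obtain z where "z \<in> lasserre_mod k I" "peval f z < 0"
        using sep_point[of f] theta[of f] ab(1) False by auto
      then show False using ab(2)[of z] closure_subset ev by fastforce
    qed
  qed
qed

end
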